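(* Let $\Omega \subset \mathbb{R}^d$ be a strictly convex bounded domain, let $0\leq \alpha < 1$, $0 < \epsilon < 1-\alpha$, and let $\lambda,\beta$ be real numbers such that $$1 \leq \beta < \frac{\log(1/\alpha)}{\log\big(1/(1-\epsilon)\big)}, \qquad 0 < \lambda < \min\Big\{\epsilon, \frac{1}{\beta}\Big\}\Big(\frac{2}{\operatorname{diam}(\Omega)}\Big)^{\beta-1}.$$ Suppose that $r:\Omega\to(0,+\infty)$ is an admissible radius function in $\Omega$ satisfying $|r(x)-r(y)|\leq |x-y|$ for all $x,y\in\Omega$, together with $$\lambda\, \operatorname{dist}(x,\partial\Omega)^{\beta} \leq r(x) \leq \epsilon\, \operatorname{dist}(x,\partial\Omega) \quad \text{for all } x\in\Omega.$$ Let $S$, $M$ be the operators associated to $r$ and to $d$-dimensional Lebesgue measure $\mu=m$, and $T_\alpha = \alpha S + (1-\alpha)M$. Then for every $f\in C(\partial\Omega)$ the Dirichlet problem $$T_\alpha u = u \ \text{ in } \Omega, \qquad u = f \ \text{ on } \partial\Omega$$ has a unique solution $\widetilde{u}\in C(\overline{\Omega})$. Furthermore, if $u_0\in C(\overline{\Omega})$ is any continuous extension of $f$ to $\overline{\Omega}$, then $H_\alpha^k u_0 \to \widetilde{u}$ uniformly in $\overline{\Omega}$ as $k\to\infty$, where $H_\alpha = \frac12(I+T_\alpha)$ and $H_\alpha^k$ denotes its $k$-th iterate.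
   Context: A bounded convex domain is strictly convex if for any $x,y\in\partial\Omega$ the open segment $(x,y)$ is contained in $\Omega$. A function $r:\Omega\to(0,+\infty)$ is an admissible radius function in $\Omega$ if $0<r(x)\leq \operatorname{dist}(x,\partial\Omega)$ for all $x\in\Omega$; write $B_x = B(x,r(x))$ for the open ball. For a positive measure $\mu$ on $\mathbb{R}^d$ and $u\in C(\overline{\Omega})$, define for $x\in\Omega$: $Su(x) = \frac12\big(\sup_{B_x}u + \inf_{B_x}u\big)$ and $Mu(x) = \frac{1}{\mu(B_x)}\int_{B_x} u\,d\mu$. When $\alpha=0$, $\log(1/\alpha)=+\infty$, so the upper bound on $\beta$ is vacuous. *)

theory Defs
  imports "HOL-Analysis.Analysis"
begin

definition strictly_convex_domain :: "'a::euclidean_space set \<Rightarrow> bool" where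
  "strictly_convex_domain \<Omega> \<longleftrightarrow> open \<Omega> \<and> connected \<Omega> \<and> \<Omega> \<noteq> {} \<and> bounded \<Omega> \<and> convex \<Omega> \<and>
     (\<forall>x\<in>frontier \<Omega>. \<forall>y\<in>frontier \<Omega>. open_segment x y \<subseteq> \<Omega>)"

definition bdist :: "'a::euclidean_space set \<Rightarrow> 'a \<Rightarrow> real" where
  "bdist \<Omega> x = infdist x (frontier \<Omega>)"

definition admissible_radius :: "'a::euclidean_space set \<Rightarrow> ('a \<Rightarrow> real) \<Rightarrow> bool" where
  "admissible_radius \<Omega> r \<longleftrightarrow> (\<forall>x\<in>\<Omega>. 0 < r x \<and> r x \<le> bdist \<Omega> x)"

definition Sop :: "('a::euclidean_space \<Rightarrow> real) \<Rightarrow> ('a \<Rightarrow> real) \<Rightarrow> 'a \<Rightarrow> real" where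
  "Sop r u x = ((SUP y\<in>ball x (r x). u y) + (INF y\<in>ball x (r x). u y)) / 2"

definition Mop :: "('a::euclidean_space \<Rightarrow> real) \<Rightarrow> ('a \<Rightarrow> real) \<Rightarrow> 'a \<Rightarrow> real" where
  "Mop r u x = (LINT y : ball x (r x) | lebesgue. u y) / measure lebesgue (ball x (r x))"

definition Top :: "real \<Rightarrow> ('a::euclidean_space \<Rightarrow> real) \<Rightarrow> ('a \<Rightarrow> real) \<Rightarrow> 'a \<Rightarrow> real" where
  "Top \<alpha> r u x = \<alpha> * Sop r u x + (1 - \<alpha>) * Mop r u x"

definition Hop :: "'a::euclidean_space set \<Rightarrow> real \<Rightarrow> ('a \<Rightarrow> real) \<Rightarrow> ('a \<Rightarrow> real) \<Rightarrow> 'a \<Rightarrow> real" where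
  "Hop \<Omega> \<alpha> r u x = (if x \<in> \<Omega> then (u x + Top \<alpha> r u x) / 2 else u x)"

definition dirichlet_solution ::
  "'a::euclidean_space set \<Rightarrow> real \<Rightarrow> ('a \<Rightarrow> real) \<Rightarrow> ('a \<Rightarrow> real) \<Rightarrow> ('a \<Rightarrow> real) \<Rightarrow> bool" where
  "dirichlet_solution \<Omega> \<alpha> r f u \<longleftrightarrow> continuous_on (closure \<Omega>) u \<and>
     (\<forall>x\<in>\<Omega>. Top \<alpha> r u x = u x) \<and> (\<forall>x\<in>frontier \<Omega>. u x = f x)"

end

(*
  Affine functions are fixed by T_alpha, because the midrange and the mean of an affine function
  over a ball both equal its value at the centre. Strict convexity provides at every boundary point
  xi an affine function that is minimal over the closed domain exactly at xi; finite minima of such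
  functions are therefore continuous supersolutions w >= u0 with w <= u0 + eta on the boundary,
  and subsolutions arise symmetrically. The iterates of u0 stay between the monotone iterates of
  the super- and the subsolution, so it suffices that the difference D_k of the latter becomes
  uniformly small. If m > 2 eta were the limit of max D_k, then the intersection of the sets
  {D_k >= m} would be a nonempty compact subset of the domain; at its point x0 nearest to the
  boundary the averaging part of T_alpha (its weight 1 - alpha is positive) forces the whole ball
  around x0 into that set, contradicting the choice of x0. The same argument applied to a constant
  sequence gives uniqueness.
*)
theory Submission
  imports Defs
begin

subsection \<open>Mean and midrange over balls\<close>

text \<open>These two properties make the supremum, the infimum and the integral over an open ball
  meaningful; without boundedness \<open>SUP\<close> and \<open>INF\<close> have unspecified
  values.\<close>

definition tame_on :: "'a::euclidean_space set \<Rightarrow> ('a \<Rightarrow> real) \<Rightarrow> bool" where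
  "tame_on A u \<longleftrightarrow> continuous_on A u \<and> bounded (u ` A)"

lemma tame_on_compact:
  assumes "compact K" "continuous_on K u" "A \<subseteq> K"
  shows "tame_on A u"
  unfolding tame_on_def
  by (meson assms bounded_subset compact_continuous_image compact_imp_bounded continuous_on_subset image_mono)

lemma tame_on_diff:
  assumes "tame_on A u" "tame_on A v"
  shows "tame_on A (\<lambda>x. u x - v x)"
  using assms unfolding tame_on_def by (simp add: continuous_on_diff bounded_minus_comp)

lemma tame_on_const: "tame_on A (\<lambda>_. c)"
  by (auto simp: tame_on_def image_constant_conv)

lemma tame_on_bdd:
  assumes "tame_on A u"
  shows "bdd_above (u ` A)" "bdd_below (u ` A)"
  using assms by (simp_all add: tame_on_def bounded_imp_bdd_above bounded_imp_bdd_below)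

text \<open>Nothing is known about \<open>u\<close> outside \<open>A\<close>, so measurability is
  that of its product with the indicator; a constant on a set of finite measure dominates this
  product.\<close>

lemma tame_on_integrable:
  fixes A :: "'a::euclidean_space set"
  assumes "tame_on A u" "open A" "bounded A"
  shows "set_integrable lebesgue A u"
proof -
  obtain B where B: "\<And>x. x \<in> A \<Longrightarrow> \<bar>u x\<bar> \<le> B"
    using assms(1) unfolding tame_on_def bounded_iff by auto
  have A: "A \<in> lmeasurable"
    using assms by (simp add: lmeasurable_open)
  have "(\<lambda>x. indicator A x *\<^sub>R u x) \<in> borel_measurable borel"
    using assms by (intro borel_measurable_continuous_on_indicator) (auto simp: tame_on_def)
  then have meas: "(\<lambda>x. indicator A x *\<^sub>R u x) \<in> borel_measurable lebesgue"
    by (intro measurable_completion) simp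
  have int: "integrable lebesgue (\<lambda>x. B * indicator A x)"
    using A by (intro integrable_mult_right) (simp add: lmeasurable_iff_integrable)
  have "norm (indicator A x *\<^sub>R u x) \<le> norm (B * indicator A x)" for x
    using B[of x] by (auto simp: indicator_def)
  then show ?thesis
    unfolding set_integrable_def by (intro Bochner_Integration.integrable_bound[OF int meas AE_I2])
qed

section \<open>Change of variables to the unit ball\<close>

text \<open>The factor \<open>s\<close> may be negative: \<open>s = -1\<close> is the reflection
  used for odd functions in \<open>Top_odd\<close>.\<close>

lemma lebesgue_ball_affine:
  fixes x :: "'a::euclidean_space" and s :: real
  assumes s: "s \<noteq> 0" and u: "set_integrable lebesgue (ball x \<bar>s\<bar>) u"
  shows "(LINT y:ball x \<bar>s\<bar>|lebesgue. u y) = \<bar>s\<bar> ^ DIM('a) * (LINT z:ball 0 1|lebesgue. u (x + s *\<^sub>R z))"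
proof -
  let ?f = "\<lambda>y. indicator (ball x \<bar>s\<bar>) y *\<^sub>R u y"
  \<comment> \<open>The library scales each coordinate by its own factor; with all factors equal to
    \<open>s\<close> that map is the dilation followed by the translation.\<close>
  have T: "(\<lambda>z::'a. x + (\<Sum>j\<in>Basis. (s * (z \<bullet> j)) *\<^sub>R j)) = (\<lambda>z. x + s *\<^sub>R z)"
    by (simp add: scaleR_scaleR[symmetric] scaleR_sum_right[symmetric] euclidean_representation del: scaleR_scaleR)
  have leb: "lebesgue = density (distr lebesgue lebesgue (\<lambda>z::'a. x + s *\<^sub>R z)) (\<lambda>_. \<bar>s\<bar> ^ DIM('a))"
    using lebesgue_affine_euclidean[of "\<lambda>_. s" x] s unfolding T by simp
  have meas: "(\<lambda>z::'a. x + s *\<^sub>R z) \<in> lebesgue \<rightarrow>\<^sub>M lebesgue"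
    using lebesgue_affine_measurable[of "\<lambda>_. s" x] s unfolding T by simp
  have f: "?f \<in> borel_measurable lebesgue"
    using u unfolding set_integrable_def by auto
  have "integral\<^sup>L lebesgue ?f = \<bar>s\<bar> ^ DIM('a) * (\<integral>z. ?f (x + s *\<^sub>R z) \<partial>lebesgue)"
    using f meas by (subst leb) (simp add: integral_density integral_distr)
  also have "(\<lambda>z. ?f (x + s *\<^sub>R z)) = (\<lambda>z. indicator (ball 0 1) z *\<^sub>R u (x + s *\<^sub>R z))"
    using s by (auto simp: indicator_def fun_eq_iff dist_norm)
  finally show ?thesis
    unfolding set_lebesgue_integral_def .
qed

text \<open>The Jacobian cancels between the integral and the volume, the latter being the integral
  of 1. Means over varying balls become means over one fixed ball.\<close>

lemma Mop_rescale:
  assumes s: "0 < r x" and u: "tame_on (ball x (r x)) u"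
  shows "Mop r u x = Mop (\<lambda>_. 1) (\<lambda>z. u (x + r x *\<^sub>R z)) 0"
proof -
  have "(LINT y:ball x (r x)|lebesgue. v y) = r x ^ DIM('a) * (LINT z:ball 0 1|lebesgue. v (x + r x *\<^sub>R z))"
    if "tame_on (ball x (r x)) v" for v :: "'a \<Rightarrow> real"
    using lebesgue_ball_affine[of "r x" x v] s tame_on_integrable[OF that] by simp
  from this[OF u] this[of "\<lambda>_. 1", OF tame_on_const] show ?thesis
    using s by (simp add: Mop_def set_lebesgue_integral_def)
qed

lemma ball_affine_image:
  fixes x :: "'a::euclidean_space"
  assumes "0 < s"
  shows "ball x s = (\<lambda>z. x + s *\<^sub>R z) ` ball 0 1"
proof safe
  fix y assume "y \<in> ball x s"
  then show "y \<in> (\<lambda>z. x + s *\<^sub>R z) ` ball 0 1"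
    using assms by (intro image_eqI[of _ _ "(1/s) *\<^sub>R (y - x)"]) (auto simp: dist_norm norm_minus_commute simp flip: scaleR_diff_right)
qed (use assms in \<open>auto simp: dist_norm\<close>)

lemma Top_rescale:
  assumes "0 < r x" "tame_on (ball x (r x)) u"
  shows "Top \<alpha> r u x = Top \<alpha> (\<lambda>_. 1) (\<lambda>z. u (x + r x *\<^sub>R z)) 0"
  unfolding Top_def Mop_rescale[of r x u, OF assms] Sop_def ball_affine_image[OF assms(1), of x] image_image ..

section \<open>Order properties of the mean and the midrange\<close>

lemma Mop_mono:
  assumes s: "0 < r x" and u: "tame_on (ball x (r x)) u" and v: "tame_on (ball x (r x)) v"
    and le: "\<And>y. y \<in> ball x (r x) \<Longrightarrow> u y \<le> v y"
  shows "Mop r u x \<le> Mop r v x"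
  unfolding Mop_def
  by (intro divide_right_mono set_integral_mono tame_on_integrable u v le) auto

lemma Mop_diff:
  assumes u: "tame_on (ball x (r x)) u" and v: "tame_on (ball x (r x)) v"
  shows "Mop r (\<lambda>y. u y - v y) x = Mop r u x - Mop r v x"
  unfolding Mop_def
  by (subst set_integral_diff) (auto simp: diff_divide_distrib intro!: tame_on_integrable u v)

lemma Mop_minus: "Mop r (\<lambda>y. - u y) x = - Mop r u x"
  unfolding Mop_def set_lebesgue_integral_def by simp

lemma Mop_const:
  assumes "0 < r x"
  shows "Mop r (\<lambda>_. c) x = c"
  using content_ball_pos[OF assms, of x] by (simp add: Mop_def set_lebesgue_integral_def mult.commute)

lemma Mop_le_const:
  assumes "0 < r x" "tame_on (ball x (r x)) u" "\<And>y. y \<in> ball x (r x) \<Longrightarrow> u y \<le> c"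
  shows "Mop r u x \<le> c"
  using Mop_mono[of r x u "\<lambda>_. c"] assms tame_on_const Mop_const[of r x c] by auto

text \<open>Compare \<open>u\<close> with the step function that is \<open>c - g\<close> on the
  small ball and \<open>c\<close> on the rest of the large one. This strictness of averaging drives
  \<open>limit_max_le_boundary\<close>.\<close>

lemma Mop_gap:
  assumes s: "0 < r x" and u: "tame_on (ball x (r x)) u"
    and le: "\<And>y. y \<in> ball x (r x) \<Longrightarrow> u y \<le> c"
    and sub: "ball z t \<subseteq> ball x (r x)" and gap: "\<And>y. y \<in> ball z t \<Longrightarrow> u y \<le> c - g"
  shows "Mop r u x \<le> c - g * (measure lebesgue (ball z t) / measure lebesgue (ball x (r x)))"
proof -
  let ?B = "ball x (r x)" and ?N = "ball z t"
  have eq: "indicator ?B y *\<^sub>R (c - g * indicator ?N y) = c * indicator ?B y - g * indicator ?N y" for y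
    using sub by (auto simp: indicator_def)
  have int1: "integrable lebesgue (indicat_real (ball y s))" for y :: 'a and s
    using lmeasurable_ball by (simp add: lmeasurable_iff_integrable)
  then have int: "integrable lebesgue (\<lambda>y. c * indicator ?B y - g * indicator ?N y)"
    by (intro Bochner_Integration.integrable_diff integrable_mult_right)
  have "(LINT y:?B|lebesgue. u y) \<le> (LINT y:?B|lebesgue. c - g * indicator ?N y)"
  proof (rule set_integral_mono)
    show "set_integrable lebesgue ?B (\<lambda>y. c - g * indicator ?N y)"
      unfolding set_integrable_def eq by (rule int)
  qed (use le gap in \<open>auto simp: indicator_def intro: tame_on_integrable u\<close>)
  also have "\<dots> = c * measure lebesgue ?B - g * measure lebesgue ?N"
    unfolding set_lebesgue_integral_def eq
    by (subst Bochner_Integration.integral_diff) (auto intro!: integrable_mult_right int1)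
  finally show ?thesis
    using content_ball_pos[OF s, of x] by (simp add: Mop_def field_simps)
qed

lemma Sop_le:
  assumes s: "0 < r x" and u: "tame_on (ball x (r x)) u" and v: "tame_on (ball x (r x)) v"
    and le: "\<And>y. y \<in> ball x (r x) \<Longrightarrow> u y \<le> v y + c"
  shows "Sop r u x \<le> Sop r v x + c"
proof -
  note bu = tame_on_bdd[OF u] and bv = tame_on_bdd[OF v]
  have ne: "ball x (r x) \<noteq> {}" using s by auto
  have "(SUP y\<in>ball x (r x). u y) \<le> (SUP y\<in>ball x (r x). v y) + c"
    by (intro cSUP_least ne) (use le cSUP_upper[OF _ bv(1)] in force)
  moreover have "(INF y\<in>ball x (r x). u y) - c \<le> (INF y\<in>ball x (r x). v y)"
    by (intro cINF_greatest ne) (use le cINF_lower[OF bu(2)] in force)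
  ultimately show ?thesis unfolding Sop_def by argo
qed

lemma Sop_minus:
  fixes x :: "'a::euclidean_space"
  shows "Sop r (\<lambda>y. - u y) x = - Sop r u x"
proof -
  have "(SUP y\<in>A. - u y) = - (INF y\<in>A. u y)" "(INF y\<in>A. - u y) = - (SUP y\<in>A. u y)" for A :: "'a set"
    by (simp_all add: Inf_real_def image_image)
  from this[of "ball x (r x)"] show ?thesis unfolding Sop_def by argo
qed

lemma Top_minus: "Top \<alpha> r (\<lambda>y. - u y) x = - Top \<alpha> r u x"
  unfolding Top_def Sop_minus Mop_minus by simp

text \<open>\<open>Sop\<close> is not linear: monotonicity and commutation with constants only bound
  its difference by \<open>c\<close>. \<open>Mop\<close> is linear, so its part retains the exact
  mean of \<open>u - v\<close>, where a strict gain can still be seen.\<close>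

lemma Top_diff_le:
  assumes "0 \<le> \<alpha>" "0 < r x" "tame_on (ball x (r x)) u" "tame_on (ball x (r x)) v"
    and "\<And>y. y \<in> ball x (r x) \<Longrightarrow> u y \<le> v y + c"
  shows "Top \<alpha> r u x - Top \<alpha> r v x \<le> \<alpha> * c + (1 - \<alpha>) * Mop r (\<lambda>y. u y - v y) x"
proof -
  have "Sop r u x \<le> Sop r v x + c"
    by (rule Sop_le) (fact assms)+
  then have "\<alpha> * Sop r u x \<le> \<alpha> * (Sop r v x + c)"
    using assms(1) by (rule mult_left_mono)
  then show ?thesis
    using Mop_diff[of x r u v, OF assms(3,4)] unfolding Top_def
    by (simp add: ring_distribs)
qed

lemma Top_le:
  assumes "0 \<le> \<alpha>" "\<alpha> \<le> 1" "0 < r x" "tame_on (ball x (r x)) u" "tame_on (ball x (r x)) v"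
    and "\<And>y. y \<in> ball x (r x) \<Longrightarrow> u y \<le> v y + c"
  shows "Top \<alpha> r u x \<le> Top \<alpha> r v x + c"
proof -
  have "Mop r (\<lambda>y. u y - v y) x \<le> c"
  proof (rule Mop_le_const)
    show "u y - v y \<le> c" if "y \<in> ball x (r x)" for y
      using assms(6)[OF that] by simp
  qed (simp_all add: assms tame_on_diff)
  then have "(1 - \<alpha>) * Mop r (\<lambda>y. u y - v y) x \<le> (1 - \<alpha>) * c"
    using assms(2) by (intro mult_left_mono) auto
  then show ?thesis
    using Top_diff_le[of \<alpha> r x u v c, OF assms(1,3-6)] by (simp add: algebra_simps)
qed

text \<open>Reflection maps the unit ball to itself. Hence the mean equals its own negative, and
  \<open>h\<close> and \<open>- h\<close> have the same image, so the midrange equals its own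
  negative too.\<close>

lemma Top_odd:
  assumes "0 \<le> \<alpha>" "\<alpha> \<le> 1" and h: "tame_on (ball 0 1) h" and odd: "\<And>z. h (- z) = - h z"
  shows "Top \<alpha> (\<lambda>_. 1) h 0 = 0"
proof -
  have "(LINT y:ball 0 1|lebesgue. h y) = (LINT y:ball 0 1|lebesgue. h (- y))"
    using lebesgue_ball_affine[of "-1" 0 h] tame_on_integrable[OF h] by simp
  also have "\<dots> = - (LINT y:ball 0 1|lebesgue. h y)"
    unfolding odd set_lebesgue_integral_def by simp
  finally have M: "Mop (\<lambda>_. 1) h 0 = 0"
    by (simp add: Mop_def)
  have "ball (0::'a) 1 = uminus ` ball 0 1"
    using ball_affine_image[of 1 "0::'a"] by (intro set_eqI iffI image_eqI[of _ uminus "- z" for z]) auto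
  then have "h ` ball 0 1 = (\<lambda>z. h (- z)) ` ball 0 1"
    by (metis image_image)
  then have "h ` ball 0 1 = (\<lambda>z. - h z) ` ball 0 1"
    unfolding odd .
  then have "Sop (\<lambda>_. 1) h 0 = Sop (\<lambda>_. 1) (\<lambda>z. - h z) 0"
    unfolding Sop_def by simp
  then have "Sop (\<lambda>_. 1) h 0 = 0"
    unfolding Sop_minus by simp
  with M show ?thesis by (simp add: Top_def)
qed

text \<open>On the unit ball the function becomes its value at the centre plus an odd linear
  function. Applying \<open>Top_le\<close> in both directions, with opposite constants, pulls the
  central value out.\<close>

lemma Top_affine:
  assumes "0 \<le> \<alpha>" "\<alpha> \<le> 1" "0 < r x"
  shows "Top \<alpha> r (\<lambda>y. a + b \<bullet> y) x = a + b \<bullet> x"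
proof -
  have tame: "tame_on (ball y s) (\<lambda>y. a + b \<bullet> y)" for a b and y :: 'a and s
    by (rule tame_on_compact[of "cball y s"]) (auto intro!: continuous_intros)
  let ?h = "\<lambda>z. (r x *\<^sub>R b) \<bullet> z"
  have h: "tame_on (ball 0 1) ?h" using tame[of 0 1 0 "r x *\<^sub>R b"] by simp
  have "Top \<alpha> (\<lambda>_. 1) ?h 0 = 0"
    using assms h by (intro Top_odd) auto
  moreover have "Top \<alpha> r (\<lambda>y. a + b \<bullet> y) x = Top \<alpha> (\<lambda>_. 1) (\<lambda>z. (a + b \<bullet> x) + ?h z) 0"
    using Top_rescale[of r x "\<lambda>y. a + b \<bullet> y" \<alpha>] assms tame by (simp add: algebra_simps inner_add_right)
  moreover have h': "tame_on (ball 0 1) (\<lambda>z. (a + b \<bullet> x) + ?h z)"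
    using tame[of 0 1 "a + b \<bullet> x" "r x *\<^sub>R b"] by simp
  then have "Top \<alpha> (\<lambda>_. 1) (\<lambda>z. (a + b \<bullet> x) + ?h z) 0 \<le> Top \<alpha> (\<lambda>_. 1) ?h 0 + (a + b \<bullet> x)"
    using assms h by (intro Top_le) auto
  moreover have "Top \<alpha> (\<lambda>_. 1) ?h 0 \<le> Top \<alpha> (\<lambda>_. 1) (\<lambda>z. (a + b \<bullet> x) + ?h z) 0 + (- (a + b \<bullet> x))"
    using assms h h' by (intro Top_le) auto
  ultimately show ?thesis by simp
qed

subsection \<open>The averaging operator on a bounded open set\<close>

locale mean_value_domain =
  fixes \<Omega> :: "'a::euclidean_space set" and \<alpha> :: real and r :: "'a \<Rightarrow> real"
  assumes open_dom: "open \<Omega>" and bounded_dom: "bounded \<Omega>"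
    and alpha_nonneg: "0 \<le> \<alpha>" and alpha_less: "\<alpha> < 1"
    and r_pos: "x \<in> \<Omega> \<Longrightarrow> 0 < r x"
    and r_le: "x \<in> \<Omega> \<Longrightarrow> r x \<le> infdist x (frontier \<Omega>)"
    and r_lipschitz: "\<lbrakk>x \<in> \<Omega>; y \<in> \<Omega>\<rbrakk> \<Longrightarrow> \<bar>r x - r y\<bar> \<le> dist x y"
begin

abbreviation H where "H \<equiv> Hop \<Omega> \<alpha> r"

lemma compact_closure_dom: "compact (closure \<Omega>)"
  using bounded_dom by (simp add: compact_closure)

lemma closure_cases:
  assumes "x \<in> closure \<Omega>" obtains "x \<in> \<Omega>" | "x \<in> frontier \<Omega>" "x \<notin> \<Omega>"
  using assms open_dom by (auto simp: frontier_def interior_open)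

lemma frontier_subset: "frontier \<Omega> \<subseteq> closure \<Omega>"
  by (auto simp: frontier_def)

lemma frontier_notin: "x \<in> frontier \<Omega> \<Longrightarrow> x \<notin> \<Omega>"
  using open_dom by (auto simp: frontier_def interior_open)

text \<open>A ball is connected, so if it left the domain it would meet the frontier at a point
  closer to \<open>x\<close> than \<open>r x\<close>, against \<open>r_le\<close>.\<close>

lemma ball_subset:
  assumes "x \<in> \<Omega>" shows "ball x (r x) \<subseteq> \<Omega>"
proof (rule ccontr)
  assume "\<not> ?thesis"
  then have "ball x (r x) - \<Omega> \<noteq> {}" by blast
  moreover have "ball x (r x) \<inter> \<Omega> \<noteq> {}"
    using assms r_pos[OF assms] centre_in_ball[of x "r x"] by blast
  ultimately obtain w where w: "w \<in> ball x (r x)" "w \<in> frontier \<Omega>"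
    using connected_Int_frontier[of "ball x (r x)" \<Omega>] by auto
  then have "infdist x (frontier \<Omega>) \<le> dist x w"
    by (intro infdist_le)
  with w r_le[OF assms] show False by simp
qed

lemma ball_subset_closure: "x \<in> \<Omega> \<Longrightarrow> ball x (r x) \<subseteq> closure \<Omega>"
  using ball_subset closure_subset by blast

lemma tame_on_ball:
  assumes "continuous_on (closure \<Omega>) u" "x \<in> \<Omega>"
  shows "tame_on (ball x (r x)) u"
  using compact_closure_dom assms(1) ball_subset_closure[OF assms(2)] by (rule tame_on_compact)

lemma H_frontier: "x \<in> frontier \<Omega> \<Longrightarrow> H u x = u x"
  using frontier_notin by (simp add: Hop_def)

lemma H_minus: "H (\<lambda>y. - u y) = (\<lambda>x. - H u x)"
  by (rule ext) (simp add: Hop_def Top_minus minus_divide_left)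

lemma H_affine: "H (\<lambda>y. a + b \<bullet> y) x = a + b \<bullet> x"
  using alpha_nonneg alpha_less r_pos by (simp add: Hop_def Top_affine)

text \<open>With \<open>c = 0\<close> this is monotonicity; used in both directions it says that
  \<open>H\<close> does not increase uniform distances.\<close>

lemma H_le:
  assumes u: "continuous_on (closure \<Omega>) u" and v: "continuous_on (closure \<Omega>) v"
    and le: "\<And>y. y \<in> closure \<Omega> \<Longrightarrow> u y \<le> v y + c" and x: "x \<in> closure \<Omega>"
  shows "H u x \<le> H v x + c"
proof (cases "x \<in> \<Omega>")
  case True
  have "Top \<alpha> r u x \<le> Top \<alpha> r v x + c"
    using alpha_nonneg alpha_less r_pos[OF True] tame_on_ball[OF u True] tame_on_ball[OF v True]
    by (rule Top_le[OF _ less_imp_le]) (use le ball_subset_closure[OF True] in blast)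
  with True le[OF x] show ?thesis by (simp add: Hop_def field_simps)
qed (simp add: Hop_def le x)

text \<open>This is the estimate that the step hypothesis of \<open>limit_max_le_boundary\<close>
  asks of a sequence of differences.\<close>

lemma H_diff_le:
  assumes u: "continuous_on (closure \<Omega>) u" and v: "continuous_on (closure \<Omega>) v"
    and le: "\<And>y. y \<in> closure \<Omega> \<Longrightarrow> u y - v y \<le> c" and x: "x \<in> \<Omega>"
  shows "H u x - H v x \<le> (u x - v x + \<alpha> * c + (1 - \<alpha>) * Mop r (\<lambda>y. u y - v y) x) / 2"
proof -
  have "u y \<le> v y + c" if "y \<in> ball x (r x)" for y
    using le[of y] ball_subset_closure[OF x] that by auto
  from Top_diff_le[of \<alpha> r x u v c, OF alpha_nonneg r_pos[OF x] tame_on_ball[OF u x] tame_on_ball[OF v x] this]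
  have "u x - v x + (Top \<alpha> r u x - Top \<alpha> r v x) \<le> u x - v x + \<alpha> * c + (1 - \<alpha>) * Mop r (\<lambda>y. u y - v y) x"
    by simp
  moreover have "H u x - H v x = (u x - v x + (Top \<alpha> r u x - Top \<alpha> r v x)) / 2"
    using x by (simp add: Hop_def diff_divide_distrib add_divide_distrib)
  ultimately show ?thesis
    by (simp only: divide_right_mono zero_le_numeral)
qed

text \<open>One formula \<open>T\<close> on the fixed unit ball covers interior and frontier alike,
  so continuity up to the boundary reduces to uniform continuity of \<open>u\<close>.\<close>

lemma continuous_on_H:
  assumes u: "continuous_on (closure \<Omega>) u"
  shows "continuous_on (closure \<Omega>) (H u)"
proof -
  \<comment> \<open>Extension of the radius by 0. It keeps the Lipschitz constant 1 up to the
    frontier because \<open>r x\<close> is at most the distance from \<open>x\<close> to any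
    frontier point.\<close>
  define R where "R x = (if x \<in> \<Omega> then r x else 0)" for x
  define g where "g x z = u (x + R x *\<^sub>R z)" for x z
  define T where "T x = Top \<alpha> (\<lambda>_. 1) (g x) 0" for x
  have in_closure: "x + R x *\<^sub>R z \<in> closure \<Omega>" if "x \<in> closure \<Omega>" "z \<in> cball 0 1" for x z
  proof (cases "x \<in> \<Omega>")
    case True
    have "closure (ball x (r x)) \<subseteq> closure \<Omega>"
      using ball_subset[OF True] by (rule closure_mono)
    then have "cball x (r x) \<subseteq> closure \<Omega>"
      using r_pos[OF True] by simp
    moreover have "x + r x *\<^sub>R z \<in> cball x (r x)"
      using that r_pos[OF True] by (simp add: dist_norm mult_left_le)
    ultimately show ?thesis using True by (auto simp: R_def)
  qed (use that in \<open>simp add: R_def\<close>)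
  have tame: "tame_on (ball 0 1) (g x)" if "x \<in> closure \<Omega>" for x
  proof (rule tame_on_compact)
    show "continuous_on (cball 0 1) (g x)"
      unfolding g_def using in_closure[OF that]
      by (intro continuous_on_compose2[OF u] continuous_intros) blast
  qed auto
  have R_le: "R x - R y \<le> dist x y" if "x \<in> closure \<Omega>" "y \<in> closure \<Omega>" for x y
  proof (cases "x \<in> \<Omega>")
    case x: True
    show ?thesis
      using that(2)
    proof (cases rule: closure_cases)
      case 1 then show ?thesis using r_lipschitz[OF x 1] x by (auto simp: R_def)
    next
      case 2
      then have "infdist x (frontier \<Omega>) \<le> dist x y" by (intro infdist_le)
      then show ?thesis using r_le[OF x] x 2 by (simp add: R_def)
    qed
  next
    case False
    then show ?thesis using r_pos[of y] zero_le_dist[of x y] by (auto simp: R_def intro: order_trans[of _ 0])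
  qed
  then have R_lip: "\<bar>R x - R y\<bar> \<le> dist x y" if "x \<in> closure \<Omega>" "y \<in> closure \<Omega>" for x y
    using R_le[OF that] R_le[OF that(2,1)] by (simp add: dist_commute)
  have "uniformly_continuous_on (closure \<Omega>) u"
    using u compact_closure_dom by (rule compact_uniformly_continuous)
  then have T_close: "\<exists>d>0. \<forall>x\<in>closure \<Omega>. \<forall>y\<in>closure \<Omega>. dist x y < d \<longrightarrow> T x \<le> T y + e" if "e > 0" for e
  proof -
    obtain d where d: "d > 0" "\<And>x y. x \<in> closure \<Omega> \<Longrightarrow> y \<in> closure \<Omega> \<Longrightarrow> dist y x < d \<Longrightarrow> dist (u y) (u x) < e"
      using \<open>uniformly_continuous_on (closure \<Omega>) u\<close> \<open>e > 0\<close> unfolding uniformly_continuous_on_def by metis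
    \<comment> \<open>The bound \<open>d / 2\<close> leaves room for the centre and the radius, each
      of which changes by at most \<open>dist x y\<close>.\<close>
    have "T x \<le> T y + e" if x: "x \<in> closure \<Omega>" and y: "y \<in> closure \<Omega>" and xy: "dist x y < d / 2" for x y
      unfolding T_def
    proof (rule Top_le[OF alpha_nonneg less_imp_le[OF alpha_less] _ tame[OF x] tame[OF y]])
      fix z :: 'a assume "z \<in> ball 0 1"
      then have z: "z \<in> cball 0 1" "norm z \<le> 1" by auto
      have "(x + R x *\<^sub>R z) - (y + R y *\<^sub>R z) = (x - y) + (R x - R y) *\<^sub>R z"
        by (simp add: algebra_simps)
      then have "dist (x + R x *\<^sub>R z) (y + R y *\<^sub>R z) \<le> norm (x - y) + \<bar>R x - R y\<bar> * norm z"
        unfolding dist_norm by (metis norm_triangle_ineq norm_scaleR)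
      also have "\<dots> \<le> dist x y + dist x y * 1"
        using R_lip[OF x y] z(2) by (intro add_mono mult_mono) (auto simp: dist_norm)
      also have "\<dots> < d" using xy by simp
      finally have "dist (g x z) (g y z) < e"
        unfolding g_def by (intro d(2) in_closure x y z)
      then show "g x z \<le> g y z + e" by (simp add: dist_real_def)
    qed simp
    with d(1) show ?thesis by (intro exI[of _ "d/2"]) auto
  qed
  have "continuous_on (closure \<Omega>) T"
    unfolding continuous_on_iff
  proof (intro ballI allI impI)
    fix x and e :: real assume x: "x \<in> closure \<Omega>" and "e > 0"
    then obtain d where d: "d > 0" "\<forall>x\<in>closure \<Omega>. \<forall>y\<in>closure \<Omega>. dist x y < d \<longrightarrow> T x \<le> T y + e/2"
      using T_close[of "e/2"] by auto
    have "dist (T y) (T x) < e" if "y \<in> closure \<Omega>" "dist y x < d" for y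
      using d(2)[rule_format, OF x that(1)] d(2)[rule_format, OF that(1) x] that(2) \<open>e > 0\<close>
      by (auto simp: dist_real_def dist_commute)
    with d(1) show "\<exists>d>0. \<forall>y\<in>closure \<Omega>. dist y x < d \<longrightarrow> dist (T y) (T x) < e" by auto
  qed
  moreover have "H u x = (u x + T x) / 2" if "x \<in> closure \<Omega>" for x
  proof (cases "x \<in> \<Omega>")
    case True
    then have "Top \<alpha> r u x = T x"
      using Top_rescale[of r x u, OF r_pos[OF True] tame_on_ball[OF u True]]
      by (simp add: T_def g_def[abs_def] R_def)
    with True show ?thesis by (simp add: Hop_def)
  next
    case False
    \<comment> \<open>At a frontier point the radius is 0 and \<open>g x\<close> is constant; the
      zero linear term puts it into the form of \<open>Top_affine\<close>.\<close>
    then have "g x = (\<lambda>z. u x + 0 \<bullet> z)" by (auto simp: g_def R_def)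
    then have "T x = u x"
      using Top_affine[OF alpha_nonneg less_imp_le[OF alpha_less], of "\<lambda>_. 1" 0 "u x" 0] by (simp add: T_def)
    with False show ?thesis by (simp add: Hop_def)
  qed
  ultimately show ?thesis
    using continuous_on_cong[OF refl, of "closure \<Omega>" "H u" "\<lambda>x. (u x + T x) / 2"] u
    by (auto intro!: continuous_intros)
qed

section \<open>Decay of maxima and comparison\<close>

text \<open>The abstract sequence serves two purposes: in \<open>iterates_squeeze\<close> it is the
  difference of two monotone iterations, in \<open>H_comparison\<close> it is constant.\<close>

lemma limit_max_le_boundary:
  fixes D :: "nat \<Rightarrow> 'a \<Rightarrow> real"
  assumes cont: "\<And>k. continuous_on (closure \<Omega>) (D k)"
    and dec: "\<And>k x. x \<in> closure \<Omega> \<Longrightarrow> D (Suc k) x \<le> D k x"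
    and step: "\<And>k x c. \<lbrakk>x \<in> \<Omega>; \<And>y. y \<in> closure \<Omega> \<Longrightarrow> D k y \<le> c\<rbrakk>
      \<Longrightarrow> D (Suc k) x \<le> (D k x + \<alpha> * c + (1 - \<alpha>) * Mop r (D k) x) / 2"
    and front: "\<And>x. x \<in> frontier \<Omega> \<Longrightarrow> D 0 x \<le> b"
    and e: "e > 0"
  shows "\<exists>k. \<forall>x\<in>closure \<Omega>. D k x \<le> b + e"
proof (rule ccontr)
  assume "\<not> ?thesis"
  then have big: "\<exists>x\<in>closure \<Omega>. b + e < D k x" for k by (auto simp: not_le)
  have ne: "closure \<Omega> \<noteq> {}" using big[of 0] by force
  have dec': "D k x \<le> D j x" if "j \<le> k" "x \<in> closure \<Omega>" for j k x
    using that(1) by (induction rule: dec_induct) (use dec that(2) order_trans in blast)+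
  have "\<exists>x\<in>closure \<Omega>. \<forall>y\<in>closure \<Omega>. D k y \<le> D k x" for k
    by (rule continuous_attains_sup[OF compact_closure_dom ne cont])
  then obtain p where p: "p k \<in> closure \<Omega>" "\<And>y. y \<in> closure \<Omega> \<Longrightarrow> D k y \<le> D k (p k)" for k
    by metis
  define s where "s k = D k (p k)" for k
  have s_gt: "b + e < s k" for k
    using big[of k] p(2)[of _ k] unfolding s_def by force
  \<comment> \<open>The maxima \<open>s k\<close> decrease, so their infimum is their limit;
    \<open>m_limit\<close> makes this explicit.\<close>
  define m where "m = (INF k. s k)"
  have bdd: "bdd_below (range s)"
    using s_gt by (intro bdd_belowI[of _ "b + e"]) (auto intro: less_imp_le)
  have m_le: "m \<le> s k" for k
    unfolding m_def by (rule cINF_lower[OF bdd]) simp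
  have m_ge: "b + e \<le> m"
    unfolding m_def by (rule cINF_greatest) (auto intro: less_imp_le s_gt)
  have s_dec: "s k \<le> s j" if "j \<le> k" for j k
    unfolding s_def using dec'[OF that p(1)[of k]] p(2)[OF p(1)[of k], of j] by simp
  have m_limit: "\<exists>j. \<forall>k\<ge>j. s k < m + g" if "g > 0" for g
  proof -
    have "\<exists>j. s j < m + g"
      using cINF_less_iff[of UNIV s "m + g"] bdd that unfolding m_def by auto
    then show ?thesis using s_dec order_le_less_trans by blast
  qed
  define K where "K k = {x \<in> closure \<Omega>. m \<le> D k x}" for k
  have "closed (K k)" for k
    unfolding K_def by (intro continuous_on_closed_Collect_le cont continuous_on_const) simp
  then have K_compact: "compact (K k)" for k
    using closed_Int_compact[OF _ compact_closure_dom, of "K k"] by (auto simp: K_def Int_absorb2)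
  have "\<Inter> (range K) \<noteq> {}"
  proof (rule compact_nest)
    fix k
    show "compact (K k)" by (rule K_compact)
    show "K k \<noteq> {}"
      using p(1)[of k] m_le[of k] unfolding K_def s_def by blast
    show "K k \<subseteq> K j" if "j \<le> k" for j
      unfolding K_def using dec'[OF that] by force
  qed
  have "compact (\<Inter> (range K))"
    using K_compact by (intro compact_Inter) auto
  then obtain x0 where x0: "x0 \<in> \<Inter> (range K)"
    and min: "\<And>y. y \<in> \<Inter> (range K) \<Longrightarrow> infdist x0 (frontier \<Omega>) \<le> infdist y (frontier \<Omega>)"
    using continuous_attains_inf[OF _ \<open>\<Inter> (range K) \<noteq> {}\<close> continuous_on_infdist[OF continuous_on_id, of _ "frontier \<Omega>"]]
    by blast
  have x0_ge: "m \<le> D k x0" for k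
    using x0 unfolding K_def by auto
  have "x0 \<in> closure \<Omega>" using x0 unfolding K_def by auto
  \<comment> \<open>On the frontier already \<open>D 0\<close> is at most \<open>b\<close>, whereas
    \<open>D 0 x0\<close> is at least \<open>m\<close>, hence at least \<open>b + e\<close>.\<close>
  moreover have "x0 \<notin> frontier \<Omega>"
    using front[of x0] x0_ge[of 0] m_ge e by auto
  ultimately have x0_in: "x0 \<in> \<Omega>" by (metis closure_cases)
  note r0 = r_pos[OF x0_in]
  \<comment> \<open>The distance to the empty set is 0 by convention, but here it is at least the
    positive number \<open>r x0\<close>.\<close>
  have "frontier \<Omega> \<noteq> {}"
    using r0 r_le[OF x0_in] by (auto simp: infdist_def)
  then obtain \<xi> where \<xi>: "\<xi> \<in> frontier \<Omega>" "infdist x0 (frontier \<Omega>) = dist x0 \<xi>"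
    using infdist_attains_inf[of "frontier \<Omega>" x0] by auto
  have dpos: "0 < r x0" "r x0 \<le> dist x0 \<xi>" using r0 r_le[OF x0_in] \<xi>(2) by auto
  \<comment> \<open>The point \<open>z\<close> lies at distance \<open>r x0 / 2\<close> from
    \<open>x0\<close> on the way to the nearest frontier point \<open>\<xi>\<close>: inside the
    ball, and strictly closer to the frontier than \<open>x0\<close>.\<close>
  define t where "t = r x0 / (2 * dist x0 \<xi>)"
  have "0 < dist x0 \<xi>" using dpos by linarith
  then have t: "0 < t" "t < 1" "t * dist x0 \<xi> < r x0"
    using dpos by (auto simp: t_def field_simps)
  define z where "z = x0 + t *\<^sub>R (\<xi> - x0)"
  have "dist x0 z < r x0"
    using t by (simp add: z_def dist_norm norm_minus_commute)
  then have z_ball: "z \<in> ball x0 (r x0)" by simp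
  have "z - \<xi> = (1 - t) *\<^sub>R (x0 - \<xi>)"
    by (simp add: z_def algebra_simps)
  then have "dist z \<xi> = (1 - t) * dist x0 \<xi>"
    using t by (simp add: dist_norm)
  then have "dist z \<xi> < dist x0 \<xi>"
    using t \<open>0 < dist x0 \<xi>\<close> by (simp add: mult_less_cancel_right2)
  then have "infdist z (frontier \<Omega>) < infdist x0 (frontier \<Omega>)"
    using infdist_le[OF \<xi>(1), of z] \<xi>(2) by simp
  then have "z \<notin> \<Inter> (range K)" using min[of z] by (meson not_le)
  then obtain j where "z \<notin> K j" by blast
  have z_in: "z \<in> \<Omega>" using z_ball ball_subset[OF x0_in] by blast
  with \<open>z \<notin> K j\<close> have j: "D j z < m"
    using closure_subset[of \<Omega>] by (auto simp: K_def)
  \<comment> \<open>Half of the deficit of \<open>D j\<close> at \<open>z\<close>; continuity may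
    consume the other half on a small ball around \<open>z\<close>.\<close>
  define g where "g = (m - D j z) / 2"
  have "g > 0" using j by (simp add: g_def)
  have "isCont (D j) z"
    using cont[of j] open_dom z_in by (meson closure_subset continuous_on_eq_continuous_at continuous_on_subset)
  then obtain d1 where d1: "d1 > 0" "\<And>y. dist y z < d1 \<Longrightarrow> dist (D j y) (D j z) < g"
    using \<open>g > 0\<close> unfolding continuous_at_eps_delta by blast
  obtain d2 where d2: "d2 > 0" "ball z d2 \<subseteq> ball x0 (r x0)"
    using z_ball open_ball open_contains_ball by metis
  define d where "d = min d1 d2"
  have d: "d > 0" "ball z d \<subseteq> ball x0 (r x0)"
    using d1 d2 by (auto simp: d_def)
  have small: "D j y \<le> m - g" if "y \<in> ball z d" for y
    using d1(2)[of y] that by (auto simp: d_def dist_real_def dist_commute g_def abs_if field_simps split: if_splits)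
  define q where "q = measure lebesgue (ball z d) / measure lebesgue (ball x0 (r x0))"
  have q: "q > 0" using d(1) r0 by (simp add: q_def content_ball_pos)
  define \<delta> where "\<delta> = (1 - \<alpha>) * (g * q) / 2"
  have "\<delta> > 0" using q \<open>g > 0\<close> alpha_less by (simp add: \<delta>_def)
  then obtain j' where j': "\<And>k. k \<ge> j' \<Longrightarrow> s k < m + \<delta>" using m_limit by blast
  \<comment> \<open>From \<open>j\<close> on the deficit near \<open>z\<close> persists, since the
    sequence decreases; from \<open>j'\<close> on the maximum is within \<open>\<delta>\<close> of
    its limit. Both are needed at once.\<close>
  define k where "k = max j j'"
  have upper: "D k y \<le> s k" if "y \<in> closure \<Omega>" for y
    using p(2)[OF that] by (simp add: s_def)
  \<comment> \<open>Relative to the upper bound \<open>s k\<close>, the bound \<open>m - g\<close>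
    near \<open>z\<close> is a gap of \<open>s k - m + g\<close>, which is at least
    \<open>g\<close>.\<close>
  have "Mop r (D k) x0 \<le> s k - (s k - m + g) * q"
    unfolding q_def
  proof (rule Mop_gap[of r x0 "D k"])
    show "D k y \<le> s k" if "y \<in> ball x0 (r x0)" for y
      using upper that ball_subset_closure[OF x0_in] by blast
    show "D k y \<le> s k - (s k - m + g)" if "y \<in> ball z d" for y
      using small[OF that] dec'[of j k y] that d(2) ball_subset_closure[OF x0_in] by (force simp: k_def)
  qed (fact r0 tame_on_ball[OF cont x0_in] d(2))+
  also have "\<dots> \<le> s k - g * q"
    using m_le[of k] q by (simp add: mult_right_mono)
  finally have M: "(1 - \<alpha>) * Mop r (D k) x0 \<le> (1 - \<alpha>) * (s k - g * q)"
    using alpha_less by (intro mult_left_mono) auto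
  have "m \<le> D (Suc k) x0" by (rule x0_ge)
  also have "\<dots> \<le> (D k x0 + \<alpha> * s k + (1 - \<alpha>) * Mop r (D k) x0) / 2"
    by (rule step[OF x0_in upper])
  also have "\<dots> \<le> (s k + \<alpha> * s k + (1 - \<alpha>) * (s k - g * q)) / 2"
    using M upper[OF \<open>x0 \<in> closure \<Omega>\<close>] by simp
  also have "\<dots> = s k - \<delta>"
    by (simp add: \<delta>_def field_simps)
  also have "\<dots> < m" using j'[of k] by (simp add: k_def)
  finally show False by simp
qed

text \<open>For functions fixed by \<open>H\<close> in the domain, the constant sequence
  \<open>u - v\<close> satisfies \<open>limit_max_le_boundary\<close> with boundary bound 0.\<close>

lemma H_comparison:
  assumes u: "continuous_on (closure \<Omega>) u" "\<And>x. x \<in> \<Omega> \<Longrightarrow> H u x = u x"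
    and v: "continuous_on (closure \<Omega>) v" "\<And>x. x \<in> \<Omega> \<Longrightarrow> H v x = v x"
    and front: "\<And>x. x \<in> frontier \<Omega> \<Longrightarrow> u x \<le> v x" and x: "x \<in> closure \<Omega>"
  shows "u x \<le> v x"
proof (rule field_le_epsilon)
  fix e :: real assume "e > 0"
  have "\<exists>k::nat. \<forall>x\<in>closure \<Omega>. u x - v x \<le> 0 + e"
  proof (rule limit_max_le_boundary[of "\<lambda>_ x. u x - v x"])
    fix x and c :: real
    assume "x \<in> \<Omega>" "\<And>y. y \<in> closure \<Omega> \<Longrightarrow> u y - v y \<le> c"
    from H_diff_le[OF u(1) v(1) this(2,1)] u(2) v(2) \<open>x \<in> \<Omega>\<close>
    show "u x - v x \<le> (u x - v x + \<alpha> * c + (1 - \<alpha>) * Mop r (\<lambda>x. u x - v x) x) / 2"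
      by simp
  qed (use front u(1) v(1) \<open>e > 0\<close> in \<open>auto intro: continuous_on_diff\<close>)
  with x show "u x \<le> v x + e" by (simp add: diff_le_eq add.commute)
qed

section \<open>Iterates and supersolutions\<close>

lemma continuous_on_iterate:
  "continuous_on (closure \<Omega>) u \<Longrightarrow> continuous_on (closure \<Omega>) ((H ^^ k) u)"
  by (induction k) (auto intro: continuous_on_H)

lemma iterate_frontier: "x \<in> frontier \<Omega> \<Longrightarrow> (H ^^ k) u x = u x"
  by (induction k) (auto simp: H_frontier)

lemma iterate_minus: "(H ^^ k) (\<lambda>y. - u y) = (\<lambda>x. - (H ^^ k) u x)"
  by (induction k) (auto simp: H_minus)

lemma iterate_mono:
  assumes "continuous_on (closure \<Omega>) u" "continuous_on (closure \<Omega>) v"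
    "\<And>x. x \<in> closure \<Omega> \<Longrightarrow> u x \<le> v x" "x \<in> closure \<Omega>"
  shows "(H ^^ k) u x \<le> (H ^^ k) v x"
  using assms(4)
proof (induction k arbitrary: x)
  case (Suc k)
  then show ?case
    using H_le[OF continuous_on_iterate[OF assms(1)] continuous_on_iterate[OF assms(2)], of k k 0 x] by simp
qed (simp add: assms)

definition supersolution :: "('a \<Rightarrow> real) \<Rightarrow> bool" where
  "supersolution w \<longleftrightarrow> continuous_on (closure \<Omega>) w \<and> (\<forall>x\<in>closure \<Omega>. H w x \<le> w x)"

lemma supersolution_affine: "supersolution (\<lambda>x. a + b \<bullet> x)"
  by (auto simp: supersolution_def H_affine intro!: continuous_intros)

text \<open>By monotonicity, \<open>H\<close> of the minimum is at most \<open>H v\<close> and at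
  most \<open>H w\<close>, hence at most \<open>v\<close> and at most \<open>w\<close>.\<close>

lemma supersolution_min:
  assumes "supersolution v" "supersolution w"
  shows "supersolution (\<lambda>x. min (v x) (w x))"
proof -
  let ?m = "\<lambda>x. min (v x) (w x)"
  have m: "continuous_on (closure \<Omega>) ?m"
    using assms by (auto simp: supersolution_def intro: continuous_on_min)
  have "H ?m x \<le> ?m x" if "x \<in> closure \<Omega>" for x
    using H_le[OF m, of v 0 x] H_le[OF m, of w 0 x] assms that by (force simp: supersolution_def)
  with m show ?thesis by (simp add: supersolution_def)
qed

text \<open>Asking only for some \<open>v\<close> below all \<open>w i\<close> includes the empty
  family, where a constant above \<open>u\<close> serves.\<close>

lemma supersolution_finite_min:
  assumes "finite I" "continuous_on (closure \<Omega>) u"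
    and "\<And>i. i \<in> I \<Longrightarrow> supersolution (w i)"
    and "\<And>i x. i \<in> I \<Longrightarrow> x \<in> closure \<Omega> \<Longrightarrow> u x \<le> w i x"
  shows "\<exists>v. supersolution v \<and> (\<forall>x\<in>closure \<Omega>. u x \<le> v x) \<and> (\<forall>i\<in>I. \<forall>x\<in>closure \<Omega>. v x \<le> w i x)"
  using assms(1,3,4)
proof (induction I)
  case empty
  have "bounded (u ` closure \<Omega>)"
    by (intro compact_imp_bounded compact_continuous_image assms(2) compact_closure_dom)
  then obtain B where "\<And>x. x \<in> closure \<Omega> \<Longrightarrow> u x \<le> B"
    unfolding bounded_iff by (auto simp: abs_le_iff)
  with supersolution_affine[of B 0] show ?case by auto
next
  case (insert i I)
  then obtain v where v: "supersolution v" "\<forall>x\<in>closure \<Omega>. u x \<le> v x" "\<forall>i\<in>I. \<forall>x\<in>closure \<Omega>. v x \<le> w i x"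
    by auto
  show ?case
    using supersolution_min[OF v(1) insert.prems(1)[of i]] v(2,3) insert.prems(2)[of i]
    by (intro exI[of _ "\<lambda>x. min (v x) (w i x)"]) (auto simp: min_le_iff_disj)
qed

text \<open>Apply the monotone operator \<open>H ^^ k\<close> to the inequality between
  \<open>H w\<close> and \<open>w\<close>.\<close>

lemma iterate_supersolution_decreasing:
  assumes "supersolution w" "x \<in> closure \<Omega>"
  shows "(H ^^ Suc k) w x \<le> (H ^^ k) w x"
proof -
  have "(H ^^ k) (H w) x \<le> (H ^^ k) w x"
    using assms by (intro iterate_mono) (auto simp: supersolution_def intro: continuous_on_H)
  then show ?thesis by (simp add: funpow_swap1)
qed

end

subsection \<open>Barriers and convergence\<close>

text \<open>Strict convexity enters in this form, derived in
  \<open>strictly_convex_domain_exposed\<close>; it is what affine barriers require.\<close>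

locale exposed_mean_value_domain = mean_value_domain +
  assumes exposed: "\<xi> \<in> frontier \<Omega> \<Longrightarrow> \<exists>b. \<forall>x\<in>closure \<Omega>. x \<noteq> \<xi> \<longrightarrow> b \<bullet> \<xi> < b \<bullet> x"
begin

text \<open>Start at \<open>u \<xi> + e / 2\<close> and add a large multiple of the functional that
  exposes \<open>\<xi>\<close>. Near \<open>\<xi>\<close> the offset dominates the variation of
  \<open>u\<close>; farther away the slope does.\<close>

lemma affine_barrier:
  assumes u: "continuous_on (closure \<Omega>) u" and e: "e > 0" and \<xi>: "\<xi> \<in> frontier \<Omega>"
  shows "\<exists>a b d. d > 0 \<and> (\<forall>x\<in>closure \<Omega>. u x \<le> a + b \<bullet> x) \<and>
    (\<forall>x\<in>closure \<Omega>. dist x \<xi> < d \<longrightarrow> a + b \<bullet> x \<le> u x + e)"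
proof -
  have \<xi>_cl: "\<xi> \<in> closure \<Omega>" using \<xi> frontier_subset by blast
  obtain b where b: "\<And>x. x \<in> closure \<Omega> \<Longrightarrow> x \<noteq> \<xi> \<Longrightarrow> b \<bullet> \<xi> < b \<bullet> x"
    using exposed[OF \<xi>] by blast
  then have b_le: "b \<bullet> \<xi> \<le> b \<bullet> x" if "x \<in> closure \<Omega>" for x
    using that by (cases "x = \<xi>") (auto intro: less_imp_le)
  obtain d where d: "d > 0" "\<And>x. x \<in> closure \<Omega> \<Longrightarrow> dist x \<xi> < d \<Longrightarrow> dist (u x) (u \<xi>) < e / 2"
    using u \<xi>_cl e unfolding continuous_on_iff by (metis half_gt_zero)
  have "bounded (u ` closure \<Omega>)"
    by (intro compact_imp_bounded compact_continuous_image u compact_closure_dom)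
  then obtain B where B: "\<And>x. x \<in> closure \<Omega> \<Longrightarrow> \<bar>u x\<bar> \<le> B"
    unfolding bounded_iff by auto
  have "B \<ge> 0" using B[OF \<xi>_cl] by simp
  let ?K = "closure \<Omega> - ball \<xi> d"
  \<comment> \<open>Compactness turns strict positivity away from \<open>\<xi>\<close> into a
    uniform bound; if no such points exist, any positive \<open>c\<close> will do.\<close>
  have "\<exists>c>0. \<forall>x\<in>?K. c \<le> b \<bullet> x - b \<bullet> \<xi>"
  proof (cases "?K = {}")
    case False
    have "compact ?K" using compact_closure_dom by (intro compact_diff) auto
    moreover have "continuous_on ?K (\<lambda>x. b \<bullet> x - b \<bullet> \<xi>)"
      by (intro continuous_intros)
    ultimately obtain y where y: "y \<in> ?K" "\<forall>x\<in>?K. b \<bullet> y - b \<bullet> \<xi> \<le> b \<bullet> x - b \<bullet> \<xi>"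
      using continuous_attains_inf[OF _ False, of "\<lambda>x. b \<bullet> x - b \<bullet> \<xi>"] by blast
    moreover have "b \<bullet> \<xi> < b \<bullet> y" using y(1) d(1) by (intro b) auto
    ultimately show ?thesis by (intro exI[of _ "b \<bullet> y - b \<bullet> \<xi>"]) auto
  qed (auto intro: exI[of _ 1])
  then obtain c where c: "c > 0" "\<And>x. x \<in> ?K \<Longrightarrow> c \<le> b \<bullet> x - b \<bullet> \<xi>" by blast
  \<comment> \<open>Chosen so that \<open>C * c = 2 * B\<close>, which bounds the oscillation of
    \<open>u\<close>.\<close>
  define C where "C = 2 * B / c"
  have C: "C \<ge> 0" "C * c = 2 * B" using \<open>B \<ge> 0\<close> c(1) by (auto simp: C_def)
  define a where "a = u \<xi> + e / 2 - C * (b \<bullet> \<xi>)"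
  have eq: "a + (C *\<^sub>R b) \<bullet> x = u \<xi> + e / 2 + C * (b \<bullet> x - b \<bullet> \<xi>)" for x
    by (simp add: a_def algebra_simps)
  have upper: "u x \<le> a + (C *\<^sub>R b) \<bullet> x" if x: "x \<in> closure \<Omega>" for x
  proof (cases "dist x \<xi> < d")
    case True
    have "C * (b \<bullet> x - b \<bullet> \<xi>) \<ge> 0" using C(1) b_le[OF x] by simp
    then show ?thesis using d(2)[OF x True] unfolding eq dist_real_def by argo
  next
    case False
    then have "C * c \<le> C * (b \<bullet> x - b \<bullet> \<xi>)"
      using C(1) c(2)[of x] x by (intro mult_left_mono) (auto simp: dist_commute)
    then show ?thesis using B[OF x] B[OF \<xi>_cl] C(2) e unfolding eq abs_le_iff by argo
  qed
  have "continuous_on (closure \<Omega>) (\<lambda>x. a + (C *\<^sub>R b) \<bullet> x - u x)"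
    by (intro continuous_intros u)
  \<comment> \<open>The barrier exceeds \<open>u\<close> by exactly \<open>e / 2\<close> at
    \<open>\<xi>\<close>, hence by less than \<open>e\<close> nearby.\<close>
  then obtain d' where d': "d' > 0"
    "\<And>x. x \<in> closure \<Omega> \<Longrightarrow> dist x \<xi> < d' \<Longrightarrow> dist (a + (C *\<^sub>R b) \<bullet> x - u x) (a + (C *\<^sub>R b) \<bullet> \<xi> - u \<xi>) < e / 2"
    using \<xi>_cl e unfolding continuous_on_iff by (metis (no_types, lifting) half_gt_zero)
  have \<xi>_val: "a + (C *\<^sub>R b) \<bullet> \<xi> - u \<xi> = e / 2" unfolding eq by simp
  have "a + (C *\<^sub>R b) \<bullet> x \<le> u x + e" if "x \<in> closure \<Omega>" "dist x \<xi> < d'" for x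
    using d'(2)[OF that] unfolding \<xi>_val dist_real_def abs_less_iff by argo
  with upper d'(1) show ?thesis by blast
qed

text \<open>By compactness, the neighbourhoods in which the barriers stay below \<open>u + e\<close>
  can be reduced to finitely many covering the frontier; a supersolution below those finitely many
  barriers is close to \<open>u\<close> there.\<close>

lemma supersolution_above:
  assumes u: "continuous_on (closure \<Omega>) u" and e: "e > 0"
  shows "\<exists>w. supersolution w \<and> (\<forall>x\<in>closure \<Omega>. u x \<le> w x) \<and> (\<forall>x\<in>frontier \<Omega>. w x \<le> u x + e)"
proof -
  obtain a b d where *: "\<And>\<xi>. \<xi> \<in> frontier \<Omega> \<Longrightarrow> d \<xi> > 0"
    "\<And>\<xi> x. \<xi> \<in> frontier \<Omega> \<Longrightarrow> x \<in> closure \<Omega> \<Longrightarrow> u x \<le> a \<xi> + b \<xi> \<bullet> x"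
    "\<And>\<xi> x. \<xi> \<in> frontier \<Omega> \<Longrightarrow> x \<in> closure \<Omega> \<Longrightarrow> dist x \<xi> < d \<xi> \<Longrightarrow> a \<xi> + b \<xi> \<bullet> x \<le> u x + e"
    using affine_barrier[OF u e] by metis
  have "compact (frontier \<Omega>)"
    using bounded_dom by (simp add: compact_frontier_bounded)
  then obtain I where I: "I \<subseteq> frontier \<Omega>" "finite I" "frontier \<Omega> \<subseteq> (\<Union>\<xi>\<in>I. ball \<xi> (d \<xi>))"
    by (rule compactE_image[of _ "frontier \<Omega>" "\<lambda>\<xi>. ball \<xi> (d \<xi>)"]) (use *(1) in auto)
  obtain w where w: "supersolution w" "\<forall>x\<in>closure \<Omega>. u x \<le> w x"
    "\<forall>\<xi>\<in>I. \<forall>x\<in>closure \<Omega>. w x \<le> a \<xi> + b \<xi> \<bullet> x"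
    using supersolution_finite_min[OF I(2) u, of "\<lambda>\<xi> x. a \<xi> + b \<xi> \<bullet> x"] *(2) I(1) supersolution_affine
    by auto
  have "w x \<le> u x + e" if x: "x \<in> frontier \<Omega>" for x
  proof -
    obtain \<xi> where \<xi>: "\<xi> \<in> I" "dist x \<xi> < d \<xi>" using I(3) x by (auto simp: dist_commute)
    have "x \<in> closure \<Omega>" using x frontier_subset by blast
    then show ?thesis using w(3) *(3)[of \<xi> x] \<xi> I(1) by force
  qed
  with w show ?thesis by blast
qed

section \<open>Convergence of the iterates\<close>

text \<open>Every iterate of \<open>u\<close> from index \<open>N\<close> on lies between
  \<open>- V N\<close> and \<open>W N\<close>, so two of them differ by at most
  \<open>W N + V N\<close>. Exchanging \<open>m\<close> and \<open>n\<close> gives the absolute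
  value.\<close>

lemma iterates_squeeze:
  assumes u: "continuous_on (closure \<Omega>) u" and e: "e > 0"
  shows "\<exists>N. \<forall>m\<ge>N. \<forall>n\<ge>N. \<forall>x\<in>closure \<Omega>. (H ^^ m) u x - (H ^^ n) u x \<le> e"
proof -
  obtain w where w: "supersolution w" "\<forall>x\<in>closure \<Omega>. u x \<le> w x" "\<forall>x\<in>frontier \<Omega>. w x \<le> u x + e / 3"
    using supersolution_above[OF u, of "e / 3"] e by auto
  \<comment> \<open>Since \<open>H\<close> is odd, \<open>- v\<close> is a subsolution below
    \<open>u\<close>; working with \<open>v\<close> spares a separate theory of
    subsolutions.\<close>
  obtain v where v: "supersolution v" "\<forall>x\<in>closure \<Omega>. - u x \<le> v x" "\<forall>x\<in>frontier \<Omega>. v x \<le> - u x + e / 3"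
    using supersolution_above[of "\<lambda>x. - u x" "e / 3"] u e by (auto intro: continuous_on_minus)
  have cont: "continuous_on (closure \<Omega>) w" "continuous_on (closure \<Omega>) v"
    using w(1) v(1) by (auto simp: supersolution_def)
  define W where "W k = (H ^^ k) w" for k
  define V where "V k = (H ^^ k) v" for k
  have contWV: "continuous_on (closure \<Omega>) (W k)" "continuous_on (closure \<Omega>) (V k)" for k
    unfolding W_def V_def by (intro continuous_on_iterate cont)+
  have Suc_W: "W (Suc k) = H (W k)" and Suc_V: "V (Suc k) = H (V k)" for k
    by (simp_all add: W_def V_def)
  have dec: "W (Suc k) x \<le> W k x" "V (Suc k) x \<le> V k x" if "x \<in> closure \<Omega>" for k x
    using iterate_supersolution_decreasing w(1) v(1) that unfolding W_def V_def by blast+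
  have dec': "W k x \<le> W j x" "V k x \<le> V j x" if "j \<le> k" "x \<in> closure \<Omega>" for j k x
    using that(1) by (induction rule: dec_induct; use dec[OF that(2)] order_trans in blast)+
  have uW: "(H ^^ k) u x \<le> W k x" if "x \<in> closure \<Omega>" for k x
    unfolding W_def using u cont w(2) that by (intro iterate_mono) auto
  have "(H ^^ k) (\<lambda>y. - u y) x \<le> V k x" if "x \<in> closure \<Omega>" for k x
    unfolding V_def using u cont v(2) that by (intro iterate_mono) (auto intro: continuous_on_minus)
  then have uV: "- (H ^^ k) u x \<le> V k x" if "x \<in> closure \<Omega>" for k x
    using that by (simp add: iterate_minus)
  \<comment> \<open>On the frontier \<open>w\<close> and \<open>v\<close> contribute
    \<open>e / 3\<close> each; the last third is the slack of the limit.\<close>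
  have "\<exists>N. \<forall>x\<in>closure \<Omega>. W N x + V N x \<le> 2 * e / 3 + e / 3"
  proof (rule limit_max_le_boundary)
    show "continuous_on (closure \<Omega>) (\<lambda>x. W k x + V k x)" for k
      by (intro continuous_on_add contWV)
    show "W (Suc k) x + V (Suc k) x \<le> W k x + V k x" if "x \<in> closure \<Omega>" for k x
      using dec[OF that] by (rule add_mono)
    show "W 0 x + V 0 x \<le> 2 * e / 3" if "x \<in> frontier \<Omega>" for x
      using bspec[OF w(3) that] bspec[OF v(3) that] by (simp add: W_def V_def)
    fix k x c assume x: "x \<in> \<Omega>" and c: "\<And>y. y \<in> closure \<Omega> \<Longrightarrow> W k y + V k y \<le> c"
    have "continuous_on (closure \<Omega>) (\<lambda>y. - V k y)"
      by (intro continuous_on_minus contWV)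
    from H_diff_le[OF contWV(1) this _ x, of k c] c
    show "W (Suc k) x + V (Suc k) x \<le> (W k x + V k x + \<alpha> * c + (1 - \<alpha>) * Mop r (\<lambda>x. W k x + V k x) x) / 2"
      by (simp add: Suc_W Suc_V H_minus)
  qed (use e in simp)
  then obtain N where N: "\<And>x. x \<in> closure \<Omega> \<Longrightarrow> W N x + V N x \<le> e" by auto
  have "(H ^^ m) u x - (H ^^ n) u x \<le> e" if "m \<ge> N" "n \<ge> N" "x \<in> closure \<Omega>" for m n x
    using uW[of x m] uV[of x n] dec'(1)[of N m x] dec'(2)[of N n x] N[of x] that by simp
  then show ?thesis by blast
qed

text \<open>The squeeze makes the iterates uniformly Cauchy. Their values on the frontier never
  change, so the limit keeps them.\<close>

lemma iterates_converge:
  assumes u: "continuous_on (closure \<Omega>) u"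
  shows "\<exists>l. continuous_on (closure \<Omega>) l \<and> (\<forall>x\<in>closure \<Omega>. H l x = l x) \<and> (\<forall>x\<in>frontier \<Omega>. l x = u x) \<and>
    uniform_limit (closure \<Omega>) (\<lambda>k. (H ^^ k) u) l sequentially"
proof -
  note cont = continuous_on_iterate[OF u]
  have "uniformly_Cauchy_on (closure \<Omega>) (\<lambda>k. (H ^^ k) u)"
  proof (rule uniformly_Cauchy_onI)
    fix e :: real assume "e > 0"
    then obtain N where N: "\<And>m n x. m \<ge> N \<Longrightarrow> n \<ge> N \<Longrightarrow> x \<in> closure \<Omega> \<Longrightarrow> (H ^^ m) u x - (H ^^ n) u x \<le> e / 2"
      using iterates_squeeze[OF u, of "e / 2"] by auto
    have "dist ((H ^^ m) u x) ((H ^^ n) u x) < e" if "x \<in> closure \<Omega>" "m \<ge> N" "n \<ge> N" for x m n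
      using N[of m n x] N[of n m x] that \<open>e > 0\<close> by (auto simp: dist_real_def)
    then show "\<exists>M. \<forall>x\<in>closure \<Omega>. \<forall>m\<ge>M. \<forall>n\<ge>M. dist ((H ^^ m) u x) ((H ^^ n) u x) < e" by blast
  qed
  then obtain l where l: "uniform_limit (closure \<Omega>) (\<lambda>k. (H ^^ k) u) l sequentially"
    using Cauchy_uniformly_convergent uniformly_convergent_on_def by blast
  have l_cont: "continuous_on (closure \<Omega>) l"
    by (rule uniform_limit_theorem[OF always_eventually l]) (simp_all add: cont)
  have lim: "(\<lambda>k. (H ^^ k) u x) \<longlonglongrightarrow> l x" if "x \<in> closure \<Omega>" for x
    using tendsto_uniform_limitI[OF l that] .
  have "l x = u x" if "x \<in> frontier \<Omega>" for x
  proof -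
    have "x \<in> closure \<Omega>" using that frontier_subset by blast
    from lim[OF this] show ?thesis
      by (simp add: iterate_frontier[OF that] tendsto_const_iff)
  qed
  moreover have "H l x = l x" if x: "x \<in> closure \<Omega>" for x
  proof -
    \<comment> \<open>\<open>H\<close> passes to the uniform limit by two uses of
      \<open>H_le\<close>, while the shifted sequence also tends to \<open>l x\<close>.\<close>
    have "(\<lambda>k. (H ^^ Suc k) u x) \<longlonglongrightarrow> H l x"
    proof (rule tendstoI)
      fix e :: real assume "e > 0"
      have "\<forall>\<^sub>F k in sequentially. \<forall>y\<in>closure \<Omega>. dist ((H ^^ k) u y) (l y) < e / 2"
        using l \<open>e > 0\<close> by (intro uniform_limitD) auto
      then show "\<forall>\<^sub>F k in sequentially. dist ((H ^^ Suc k) u x) (H l x) < e"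
      proof (rule eventually_mono)
        fix k assume k: "\<forall>y\<in>closure \<Omega>. dist ((H ^^ k) u y) (l y) < e / 2"
        have close: "(H ^^ k) u y \<le> l y + e / 2" "l y \<le> (H ^^ k) u y + e / 2" if "y \<in> closure \<Omega>" for y
          using bspec[OF k that] unfolding dist_real_def by argo+
        have "H ((H ^^ k) u) x \<le> H l x + e / 2"
          by (rule H_le[OF cont l_cont close(1) x])
        moreover have "H l x \<le> H ((H ^^ k) u) x + e / 2"
          by (rule H_le[OF l_cont cont close(2) x])
        ultimately show "dist ((H ^^ Suc k) u x) (H l x) < e"
          using \<open>e > 0\<close> by (simp add: dist_real_def)
      qed
    qed
    moreover have "(\<lambda>k. (H ^^ Suc k) u x) \<longlonglongrightarrow> l x"
      using lim[OF x] by (rule LIMSEQ_Suc)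
    ultimately show ?thesis by (rule LIMSEQ_unique)
  qed
  ultimately show ?thesis using l l_cont by blast
qed

end

section \<open>Strictly convex domains and the Dirichlet problem\<close>

text \<open>A supporting hyperplane at \<open>\<xi>\<close> is strict on the open domain. For
  another frontier point \<open>x\<close> the midpoint lies in the domain, and strictness there
  forces strictness at \<open>x\<close>.\<close>

lemma strictly_convex_domain_exposed:
  assumes dom: "strictly_convex_domain \<Omega>" and \<xi>: "\<xi> \<in> frontier \<Omega>"
  shows "\<exists>b. \<forall>x\<in>closure \<Omega>. x \<noteq> \<xi> \<longrightarrow> b \<bullet> \<xi> < b \<bullet> x"
proof -
  have \<Omega>: "open \<Omega>" "convex \<Omega>" "\<And>x y. x \<in> frontier \<Omega> \<Longrightarrow> y \<in> frontier \<Omega> \<Longrightarrow> open_segment x y \<subseteq> \<Omega>"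
    using dom by (auto simp: strictly_convex_domain_def)
  have rel: "rel_interior \<Omega> = \<Omega>" using \<Omega>(1) by (rule rel_interior_open)
  have "\<xi> \<in> closure \<Omega>" "\<xi> \<notin> \<Omega>"
    using \<xi> \<Omega>(1) by (auto simp: frontier_def interior_open)
  then obtain b where b: "\<And>y. y \<in> closure \<Omega> \<Longrightarrow> b \<bullet> \<xi> \<le> b \<bullet> y" "\<And>y. y \<in> \<Omega> \<Longrightarrow> b \<bullet> \<xi> < b \<bullet> y"
    using supporting_hyperplane_relative_frontier[of \<Omega> \<xi>] \<Omega>(2) unfolding rel by metis
  have "b \<bullet> \<xi> < b \<bullet> x" if x: "x \<in> closure \<Omega>" "x \<noteq> \<xi>" for x
  proof (cases "x \<in> \<Omega>")
    case False
    then have "x \<in> frontier \<Omega>" using x \<Omega>(1) by (auto simp: frontier_def interior_open)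
    then have "midpoint \<xi> x \<in> \<Omega>"
      using \<Omega>(3)[OF \<xi>] midpoint_in_open_segment[of \<xi> x] x(2) by blast
    from b(2)[OF this] show ?thesis
      by (simp add: midpoint_def inner_add_right inner_scaleR_right)
  qed (rule b(2))
  then show ?thesis by blast
qed

theorem theorem1:
  fixes \<Omega> :: "'a::euclidean_space set"
    and r :: "'a \<Rightarrow> real"
    and \<alpha> \<epsilon> lam \<beta> :: real
  assumes dom: "strictly_convex_domain \<Omega>"
    and alpha: "0 \<le> \<alpha>" "\<alpha> < 1"
    and eps: "0 < \<epsilon>" "\<epsilon> < 1 - \<alpha>"
    and beta: "1 \<le> \<beta>" "\<alpha> = 0 \<or> \<beta> < ln (1 / \<alpha>) / ln (1 / (1 - \<epsilon>))"
    and lam: "0 < lam" "lam < min \<epsilon> (1 / \<beta>) * (2 / diameter \<Omega>) powr (\<beta> - 1)"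
    and adm: "admissible_radius \<Omega> r"
    and lip: "\<forall>x\<in>\<Omega>. \<forall>y\<in>\<Omega>. \<bar>r x - r y\<bar> \<le> dist x y"
    and rbounds: "\<forall>x\<in>\<Omega>. lam * bdist \<Omega> x powr \<beta> \<le> r x \<and> r x \<le> \<epsilon> * bdist \<Omega> x"
  shows "\<forall>f. continuous_on (frontier \<Omega>) f \<longrightarrow>
           (\<exists>u. dirichlet_solution \<Omega> \<alpha> r f u
              \<and> (\<forall>v. dirichlet_solution \<Omega> \<alpha> r f v \<longrightarrow> (\<forall>x\<in>closure \<Omega>. v x = u x))
              \<and> (\<forall>u0. continuous_on (closure \<Omega>) u0 \<and> (\<forall>x\<in>frontier \<Omega>. u0 x = f x) \<longrightarrow>
                   uniform_limit (closure \<Omega>) (\<lambda>k. (Hop \<Omega> \<alpha> r ^^ k) u0) u sequentially))"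
proof -
  interpret exposed_mean_value_domain \<Omega> \<alpha> r
  proof
    show "open \<Omega>" "bounded \<Omega>" using dom by (auto simp: strictly_convex_domain_def)
  qed (use alpha adm lip strictly_convex_domain_exposed[OF dom] in
      \<open>auto simp: admissible_radius_def bdist_def\<close>)
  \<comment> \<open>In the domain \<open>H u x\<close> is the average of \<open>u x\<close> and
    \<open>Top \<alpha> r u x\<close>, so both operators have the same fixed points.\<close>
  have solution_iff: "dirichlet_solution \<Omega> \<alpha> r f u \<longleftrightarrow> continuous_on (closure \<Omega>) u \<and>
      (\<forall>x\<in>\<Omega>. H u x = u x) \<and> (\<forall>x\<in>frontier \<Omega>. u x = f x)" for f u
    by (auto simp: dirichlet_solution_def Hop_def)
  have unique: "v x = u x" if "dirichlet_solution \<Omega> \<alpha> r f u" "dirichlet_solution \<Omega> \<alpha> r f v" "x \<in> closure \<Omega>"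
    for f u v x
    using that H_comparison[of u v x] H_comparison[of v u x] by (force simp: solution_iff)
  have converge: "\<exists>l. dirichlet_solution \<Omega> \<alpha> r f l \<and> uniform_limit (closure \<Omega>) (\<lambda>k. (H ^^ k) u0) l sequentially"
    if "continuous_on (closure \<Omega>) u0" "\<forall>x\<in>frontier \<Omega>. u0 x = f x" for f u0
    using iterates_converge[OF that(1)] that(2) closure_subset unfolding solution_iff by (metis subsetD)
  show ?thesis
  proof (intro allI impI)
    fix f :: "'a \<Rightarrow> real" assume f: "continuous_on (frontier \<Omega>) f"
    \<comment> \<open>A continuous extension of \<open>f\<close>, needed as a first starting
      function; the limit of its iterates is the solution.\<close>
    obtain g :: "'a \<Rightarrow> real" where g: "continuous_on UNIV g" "\<And>x. x \<in> frontier \<Omega> \<Longrightarrow> g x = f x"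
      using Tietze_unbounded[OF f, of UNIV] by auto
    then obtain u where u: "dirichlet_solution \<Omega> \<alpha> r f u"
      using converge[of g f] continuous_on_subset[OF g(1)] by auto
    \<comment> \<open>Another extension of \<open>f\<close> converges to some solution
      \<open>l\<close>, which uniqueness identifies with \<open>u\<close> on the closure.\<close>
    have "uniform_limit (closure \<Omega>) (\<lambda>k. (H ^^ k) u0) u sequentially"
      if "continuous_on (closure \<Omega>) u0" "\<forall>x\<in>frontier \<Omega>. u0 x = f x" for u0
    proof -
      from converge[OF that] obtain l where l: "dirichlet_solution \<Omega> \<alpha> r f l"
        "uniform_limit (closure \<Omega>) (\<lambda>k. (H ^^ k) u0) l sequentially"
        by blast
      with unique[OF u l(1)] show ?thesis
        by (subst (asm) uniform_limit_cong'[of _ _ _ l u]) auto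
    qed
    with u unique show "\<exists>u. dirichlet_solution \<Omega> \<alpha> r f u
              \<and> (\<forall>v. dirichlet_solution \<Omega> \<alpha> r f v \<longrightarrow> (\<forall>x\<in>closure \<Omega>. v x = u x))
              \<and> (\<forall>u0. continuous_on (closure \<Omega>) u0 \<and> (\<forall>x\<in>frontier \<Omega>. u0 x = f x) \<longrightarrow>
                   uniform_limit (closure \<Omega>) (\<lambda>k. (H ^^ k) u0) u sequentially)"
      by blast
  qed
qed

end
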